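(* Let $(F,\le)$ be an ordered field and let $k,l,n$ be positive integers. For every $A\in M_{k,n}(F)$ and $B\in M_{l,n}(F)$, we have $A\succeq_n B$ if and only if $A=CB$ for some bounded matrix $C\in M_{k,l}(F)$.
   Context: Let $M_{m,n}(F)$ be the set of $m\times n$ matrices over $F$ and $M_{\ast,n}(F)=\bigcup_{m\ge 1}M_{m,n}(F)$. For symmetric $S,T\in M_n(F)$ write $S\le_n T$ iff $T-S$ is positive semidefinite, i.e. $v^T(T-S)v\ge 0$ for all $v\in F^n$. For $A,B\in M_{\ast,n}(F)$ (possibly with different numbers of rows) write $A\succeq_n B$ iff there is $r\in\mathbb N$ such that $A^TA\le_n rB^TB$. A matrix $C\in M_{k,l}(F)$ is called bounded if $C\succeq_l I_l$, where $I_l$ is the $l\times l$ identity matrix. *)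

theory Defs
  imports "HOL-Analysis.Analysis"
begin

text \<open>
  \<open>M\<^bsub>m,n\<^esub>(F)\<close> is the type \<open>'a ^ 'n ^ 'm\<close>, with \<open>m = CARD('m)\<close> rows and \<open>n = CARD('n)\<close>
  columns; both are positive because index types are nonempty. The union over all numbers of rows
  is rendered by letting the row types of the two arguments below vary independently.
\<close>

definition pos_semidef :: "'a::linordered_field ^ 'n ^ 'n \<Rightarrow> bool" where
  "pos_semidef M \<longleftrightarrow> (\<forall>v. scalar_product v (M *v v) \<ge> 0)"

text \<open>
  The Loewner order is only meant for symmetric \<open>S\<close> and \<open>T\<close>; below it is only applied to
  multiples of Gram matrices \<open>A\<^sup>T A\<close>, which are symmetric.
\<close>

definition loewner_le :: "'a::linordered_field ^ 'n ^ 'n \<Rightarrow> 'a ^ 'n ^ 'n \<Rightarrow> bool" where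
  "loewner_le S T \<longleftrightarrow> pos_semidef (T - S)"

text \<open>
  \<open>mat_succeq A B\<close> is \<open>A \<succeq>\<^sub>n B\<close>. Despite the direction of the symbol, it is the
  Gram matrix of the first argument that is bounded by a multiple of that of the second.
\<close>

definition mat_succeq :: "'a::linordered_field ^ 'n ^ 'k \<Rightarrow> 'a ^ 'n ^ 'l \<Rightarrow> bool" where
  "mat_succeq A B \<longleftrightarrow>
    (\<exists>r::nat. loewner_le (transpose A ** A) (\<chi> i j. of_nat r * (transpose B ** B) $ i $ j))"

definition mat_bounded :: "'a::linordered_field ^ 'l ^ 'k \<Rightarrow> bool" where
  "mat_bounded C \<longleftrightarrow> mat_succeq C (mat 1 :: 'a ^ 'l ^ 'l)"

end

theory Submission
  imports Defs
begin

text \<open>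
  Evaluated on vectors, \<open>mat_succeq A B\<close> says that \<open>\<parallel>A v\<parallel>\<^sup>2 \<le> r \<parallel>B v\<parallel>\<^sup>2\<close> for some natural number
  \<open>r\<close> and all \<open>v\<close>, where \<open>\<parallel>v\<parallel>\<^sup>2\<close> stands for \<open>scalar_product v v\<close> (lemma \<open>mat_succeq_iff\<close>).
  If \<open>A = C ** B\<close> with \<open>C\<close> bounded, substitute \<open>B v\<close> into the inequality for \<open>C\<close>.

  For the converse, the inequality forces \<open>A\<close> to vanish on the kernel of \<open>B\<close>, so \<open>A\<close> factors through
  the column space of \<open>B\<close>, and on that space the factor is bounded by the same \<open>r\<close>. The issue is to
  extend the factor to the whole space without losing the bound. The extension by zero on the
  orthogonal complement does this, because the orthogonal projection onto the column space does not
  increase norms. Over an arbitrary ordered field square roots may be missing, so there are no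
  orthonormal bases in general; but Gram--Schmidt without normalization only divides by the elements
  \<open>\<parallel>a\<parallel>\<^sup>2\<close>, which are nonzero for \<open>a \<noteq> 0\<close> since the field is ordered. Hence orthogonal projections
  exist (lemma \<open>orthogonal_projection_exists\<close>).

  In matrix terms the projection yields \<open>G\<close> with \<open>B\<^sup>T B G = B\<^sup>T\<close> (lemma
  \<open>normal_equations_solution\<close>): \<open>G w\<close> is a least-squares solution of \<open>B x = w\<close>, the projection is
  \<open>B G\<close>, and the factor sought is \<open>C = A G\<close>.
\<close>

lemma scalar_product_add_left:
  "scalar_product (u + v) w = scalar_product u w + scalar_product v w"
  by (simp add: scalar_product_def distrib_right sum.distrib)

lemma scalar_product_add_right:
  "scalar_product w (u + v) = scalar_product w u + scalar_product w v"
  by (simp add: scalar_product_def distrib_left sum.distrib)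

lemma scalar_product_diff_right:
  fixes u :: "'a::ring_1 ^ 'n"
  shows "scalar_product w (u - v) = scalar_product w u - scalar_product w v"
  by (simp add: scalar_product_def right_diff_distrib sum_subtractf)

lemma scalar_product_scale_left:
  "scalar_product (c *s u) w = c * scalar_product u w"
  by (simp add: scalar_product_def sum_distrib_left mult.assoc)

lemma scalar_product_scale_right:
  fixes u :: "'a::comm_ring_1 ^ 'n"
  shows "scalar_product w (c *s u) = c * scalar_product w u"
  by (simp add: scalar_product_def sum_distrib_left mult.left_commute)

lemma scalar_product_commute:
  fixes u :: "'a::comm_ring_1 ^ 'n"
  shows "scalar_product u w = scalar_product w u"
  by (simp add: scalar_product_def mult.commute)

lemma scalar_product_0_left [simp]: "scalar_product 0 w = 0"
  by (simp add: scalar_product_def)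

lemma scalar_product_self_nonneg:
  fixes u :: "'a::linordered_field ^ 'n"
  shows "0 \<le> scalar_product u u"
  by (simp add: scalar_product_def sum_nonneg)

lemma scalar_product_self_eq_0_iff:
  fixes u :: "'a::linordered_field ^ 'n"
  shows "scalar_product u u = 0 \<longleftrightarrow> u = 0"
  by (simp add: scalar_product_def sum_nonneg_eq_0_iff vec_eq_iff)

lemma scalar_product_matrix_vector_mult:
  fixes M :: "'a::comm_ring_1 ^ 'n ^ 'm"
  shows "scalar_product v (M *v w) = scalar_product (transpose M *v v) w"
proof -
  have "scalar_product v (M *v w) = (\<Sum>i\<in>UNIV. \<Sum>j\<in>UNIV. v $ i * (M $ i $ j * w $ j))"
    by (simp add: scalar_product_def matrix_vector_mult_def sum_distrib_left)
  also have "\<dots> = (\<Sum>j\<in>UNIV. \<Sum>i\<in>UNIV. v $ i * (M $ i $ j * w $ j))"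
    by (rule sum.swap)
  also have "\<dots> = scalar_product (transpose M *v v) w"
    by (simp add: scalar_product_def matrix_vector_mult_def transpose_def sum_distrib_right
        mult.assoc mult.left_commute)
  finally show ?thesis .
qed

lemma scalar_product_gram:
  fixes M :: "'a::comm_ring_1 ^ 'n ^ 'm"
  shows "scalar_product v ((transpose M ** M) *v v) = scalar_product (M *v v) (M *v v)"
  by (simp add: scalar_product_matrix_vector_mult matrix_transpose_mul matrix_vector_mul_assoc)

lemma mat_succeq_iff:
  fixes A :: "'a::linordered_field ^ 'n ^ 'k" and B :: "'a ^ 'n ^ 'l"
  shows "mat_succeq A B \<longleftrightarrow>
    (\<exists>r::nat. \<forall>v. scalar_product (A *v v) (A *v v) \<le> of_nat r * scalar_product (B *v v) (B *v v))"
proof -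
  have "((\<chi> i j. of_nat r * (transpose B ** B) $ i $ j) - transpose A ** A) *v v
      = of_nat r *s ((transpose B ** B) *v v) - (transpose A ** A) *v v" for r :: nat and v
    by (simp add: vec_eq_iff matrix_vector_mult_def sum_distrib_left left_diff_distrib
        sum_subtractf mult.assoc)
  then show ?thesis
    by (simp add: mat_succeq_def loewner_le_def pos_semidef_def scalar_product_diff_right
        scalar_product_scale_right scalar_product_gram)
qed

lemma mat_bounded_iff:
  fixes C :: "'a::linordered_field ^ 'l ^ 'k"
  shows "mat_bounded C \<longleftrightarrow>
    (\<exists>r::nat. \<forall>w. scalar_product (C *v w) (C *v w) \<le> of_nat r * scalar_product w w)"
  by (simp add: mat_bounded_def mat_succeq_iff)

text \<open>
  Induction on \<open>S\<close> is one Gram--Schmidt step: to adjoin \<open>a\<close>, take \<open>b\<close>, the part of \<open>a\<close> orthogonal to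
  \<open>S\<close>, and correct the projection of \<open>w\<close> by its component along \<open>b\<close>.
\<close>

lemma orthogonal_projection_exists:
  fixes S :: "('a::linordered_field ^ 'l) set"
  assumes "finite S"
  shows "\<exists>p\<in>vec.span S. \<forall>s\<in>vec.span S. scalar_product s (w - p) = 0"
  using assms
proof (induction S arbitrary: w)
  case empty
  show ?case by simp
next
  case (insert a S)
  obtain q where q: "q \<in> vec.span S" "\<And>s. s \<in> vec.span S \<Longrightarrow> scalar_product s (a - q) = 0"
    using insert.IH by blast
  obtain p where p: "p \<in> vec.span S" "\<And>s. s \<in> vec.span S \<Longrightarrow> scalar_product s (w - p) = 0"
    using insert.IH by blast
  define b where "b = a - q"
  \<comment> \<open>If \<open>a\<close> already lies in the span of \<open>S\<close>, then \<open>b = 0\<close> and division by zero gives \<open>c = 0\<close>, so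
    that \<open>p\<close> is kept.\<close>
  define c where "c = scalar_product b (w - p) / scalar_product b b"
  define p' where "p' = p + c *s b"
  have mono: "s \<in> vec.span (insert a S)" if "s \<in> vec.span S" for s
    using that vec.span_mono[of S "insert a S"] by blast
  have "b \<in> vec.span (insert a S)"
    unfolding b_def by (rule vec.span_diff[OF vec.span_base mono[OF q(1)]]) simp
  then have "p' \<in> vec.span (insert a S)"
    unfolding p'_def by (intro vec.span_add[OF mono[OF p(1)]] vec.span_scale)
  moreover have "scalar_product s (w - p') = 0" if "s \<in> vec.span (insert a S)" for s
  proof -
    have diff: "w - p' = (w - p) - c *s b"
      by (simp add: p'_def)
    have orth_S: "scalar_product t (w - p') = 0" if "t \<in> vec.span S" for t
      using p(2)[OF that] q(2)[OF that, folded b_def]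
      by (simp add: diff scalar_product_diff_right[of _ "w - p"] scalar_product_scale_right)
    have orth_b: "scalar_product b (w - p') = 0"
    proof (cases "b = 0")
      case False
      then have "scalar_product b b \<noteq> 0"
        by (simp add: scalar_product_self_eq_0_iff)
      then show ?thesis
        by (simp add: diff scalar_product_diff_right[of _ "w - p"] scalar_product_scale_right c_def)
    qed simp
    obtain k where k: "s - k *s a \<in> vec.span S"
      using \<open>s \<in> vec.span (insert a S)\<close> vec.span_breakdown_eq by blast
    have "s = (s - k *s a) + k *s (b + q)"
      by (simp add: b_def)
    then have "scalar_product s (w - p')
        = scalar_product (s - k *s a) (w - p')
          + k * (scalar_product b (w - p') + scalar_product q (w - p'))"
      by (metis scalar_product_add_left scalar_product_scale_left)
    then show ?thesis
      using orth_S[OF k] orth_S[OF q(1)] orth_b by simp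
  qed
  ultimately show ?case by blast
qed

text \<open>
  Column \<open>j\<close> of \<open>G\<close> is a preimage under \<open>B\<close> of the projection of the \<open>j\<close>-th unit vector onto the
  column space of \<open>B\<close>; the equation says that the residuals are orthogonal to that space.
\<close>

lemma normal_equations_solution:
  fixes B :: "'a::linordered_field ^ 'n ^ 'l"
  shows "\<exists>G :: 'a ^ 'l ^ 'n. transpose B ** (B ** G) = transpose B"
proof -
  have "\<exists>x. transpose B *v (B *v x) = transpose B *v w" for w
  proof -
    have span: "vec.span ((*v) B ` cart_basis) = range ((*v) B)"
      by (simp add: vec.span_image span_cart_basis)
    have "finite ((*v) B ` cart_basis)"
      by (simp add: finite_cart_basis)
    then obtain p where "p \<in> range ((*v) B)"
      and orth: "\<forall>s\<in>range ((*v) B). scalar_product s (w - p) = 0"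
      using orthogonal_projection_exists[of "(*v) B ` cart_basis" w] unfolding span by blast
    then obtain x where x: "p = B *v x"
      by blast
    let ?d = "transpose B *v (w - p)"
    have "scalar_product ?d ?d = scalar_product (B *v ?d) (w - p)"
      by (metis scalar_product_matrix_vector_mult scalar_product_commute)
    then have "?d = 0"
      using orth by (simp flip: scalar_product_self_eq_0_iff)
    then show ?thesis
      by (intro exI[of _ x]) (simp add: x vec.diff)
  qed
  then obtain x where x: "\<And>w. transpose B *v (B *v x w) = transpose B *v w"
    by metis
  define G :: "'a ^ 'l ^ 'n" where "G = (\<chi> i j. x (axis j 1) $ i)"
  have column: "M *v axis j 1 = column j M" for M :: "'a ^ 'l ^ 'm" and j
    by (simp add: vec_eq_iff matrix_vector_mult_def column_def axis_def if_distrib cong: if_cong)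
  have "column j (transpose B ** (B ** G)) = column j (transpose B)" for j
  proof -
    have "G *v axis j 1 = x (axis j 1)"
      by (simp add: column column_def G_def)
    then show ?thesis
      using x[of "axis j 1"] by (simp flip: column matrix_vector_mul_assoc)
  qed
  then have "transpose B ** (B ** G) = transpose B"
    by (simp add: column_def vec_eq_iff)
  then show ?thesis ..
qed

theorem proposition5p1:
  fixes A :: "'a::linordered_field ^ 'n ^ 'k"
    and B :: "'a ^ 'n ^ 'l"
  shows "mat_succeq A B \<longleftrightarrow> (\<exists>C :: 'a ^ 'l ^ 'k. mat_bounded C \<and> A = C ** B)"
proof
  assume "\<exists>C :: 'a ^ 'l ^ 'k. mat_bounded C \<and> A = C ** B"
  then obtain C :: "'a ^ 'l ^ 'k" and r :: nat where
    "\<And>w. scalar_product (C *v w) (C *v w) \<le> of_nat r * scalar_product w w" and "A = C ** B"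
    by (auto simp: mat_bounded_iff)
  then show "mat_succeq A B"
    by (auto simp: mat_succeq_iff simp flip: matrix_vector_mul_assoc)
next
  assume "mat_succeq A B"
  then obtain r :: nat where
    r: "\<And>v. scalar_product (A *v v) (A *v v) \<le> of_nat r * scalar_product (B *v v) (B *v v)"
    by (auto simp: mat_succeq_iff)
  obtain G :: "'a ^ 'l ^ 'n" where G: "transpose B ** (B ** G) = transpose B"
    using normal_equations_solution by blast
  have residual: "transpose B *v (w - B *v (G *v w)) = 0" for w
    using arg_cong[OF G, of "\<lambda>M. M *v w"] by (simp add: vec.diff flip: matrix_vector_mul_assoc)
  have orth: "scalar_product (w - B *v (G *v w)) (B *v v) = 0" for w v
    using residual[of w] by (simp add: scalar_product_matrix_vector_mult)
  have "A *v (G *v (B *v v)) = A *v v" for v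
  proof -
    let ?d = "v - G *v (B *v v)"
    \<comment> \<open>\<open>B ?d\<close> is both a residual and an element of the column space, hence orthogonal to itself.\<close>
    have "scalar_product (B *v ?d) (B *v ?d) = 0"
      using orth[of "B *v v" ?d] by (simp add: vec.diff)
    then have "scalar_product (A *v ?d) (A *v ?d) = 0"
      using r[of ?d] scalar_product_self_nonneg[of "A *v ?d"] by simp
    then show ?thesis
      by (simp add: scalar_product_self_eq_0_iff vec.diff)
  qed
  then have factor: "A = (A ** G) ** B"
    by (simp add: matrix_eq flip: matrix_vector_mul_assoc)
  have contraction: "scalar_product (B *v (G *v w)) (B *v (G *v w)) \<le> scalar_product w w" for w
  proof -
    let ?p = "B *v (G *v w)"
    have "scalar_product w w = scalar_product ((w - ?p) + ?p) ((w - ?p) + ?p)"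
      by simp
    also have "\<dots> = scalar_product (w - ?p) (w - ?p) + scalar_product ?p ?p"
      using orth[of w "G *v w"] scalar_product_commute[of ?p "w - ?p"]
      by (simp only: scalar_product_add_left scalar_product_add_right)
    finally show ?thesis
      using scalar_product_self_nonneg[of "w - ?p"] by simp
  qed
  have "scalar_product ((A ** G) *v w) ((A ** G) *v w) \<le> of_nat r * scalar_product w w" for w
    using r[of "G *v w"] mult_left_mono[OF contraction[of w], of "of_nat r"]
    by (simp flip: matrix_vector_mul_assoc)
  then have "mat_bounded (A ** G)"
    by (auto simp: mat_bounded_iff)
  with factor show "\<exists>C :: 'a ^ 'l ^ 'k. mat_bounded C \<and> A = C ** B"
    by blast
qed

end
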